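(* Let $Z_1\in\mathbb{R}^{N\times m}$, $Z_2\in\mathbb{R}^{N^2\times m}$, $\dot Z\in\mathbb{R}^{N\times m}$ be the data matrices built from training data $\{(x^{(k)},\dot x^{(k)})\}_{k=1}^m$ and a dictionary $\phi$, and consider the problem of minimizing $$L(A,B,C)=\left\lVert \dot Z-A Z_2-B Z_1-C\,\mathbf{1}_m^\top\right\rVert_F^2$$ over $A\in\mathbb{R}^{N\times N^2}$, $B\in\mathbb{R}^{N\times N}$, $C\in\mathbb{R}^N$. For $\ell=1,\dots,N$ let $\dot Z_\ell$ denote the $\ell$th row of $\dot Z$ and define $$R=\begin{bmatrix} Z_2Z_2^\top & Z_2Z_1^\top & Z_2\mathbf{1}_m\\ Z_1Z_2^\top & Z_1Z_1^\top & Z_1\mathbf{1}_m\\ \mathbf{1}_m^\top Z_2^\top & \mathbf{1}_m^\top Z_1^\top & m\end{bmatrix},\qquad s_\ell=\begin{bmatrix} Z_2\dot Z_\ell^\top\\ Z_1\dot Z_\ell^\top\\ \mathbf{1}_m^\top\dot Z_\ell^\top\end{bmatrix}.$$ Then an optimal solution $(A,B,C)$ is obtained row-wise by solving the $N$ decoupled linear systems $R\,v_\ell=s_\ell$, $\ell=1,\dots,N$, of size $N^2+N+1$, where $v_\ell=\begin{bmatrix}A_\ell^\top\\ B_\ell^\top\\ C_\ell\end{bmatrix}$, with $A_\ell$, $B_\ell$ the $\ell$th rows of $A$, $B$ and $C_\ell$ the $\ell$th entry of $C$. Moreover, $v_\ell=R^+s_\ell$ is the solution of $R\,v_\ell=s_\ell$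 with the smallest 2-norm.
   Context: Training data are pairs $(x^{(k)},\dot x^{(k)})\in\mathbb{R}^n\times\mathbb{R}^n$, $k=1,\dots,m$. The dictionary $\phi=(\phi_1,\dots,\phi_N)^\top:\mathbb{R}^n\to\mathbb{R}^N$ consists of differentiable basis functions, with Jacobian $J(x)\in\mathbb{R}^{N\times n}$ whose $i$th row is $\nabla\phi_i(x)^\top$. Set $z^{(k)}=\phi(x^{(k)})$ and $\dot z^{(k)}=J(x^{(k)})\,\dot x^{(k)}$. The data matrices are $Z_1=[z^{(1)}\ \cdots\ z^{(m)}]$, $Z_2=[z^{(1)}\otimes z^{(1)}\ \cdots\ z^{(m)}\otimes z^{(m)}]$ (with $\otimes$ the Kronecker product), and $\dot Z=[\dot z^{(1)}\ \cdots\ \dot z^{(m)}]$. $\lVert\cdot\rVert_F$ is the Frobenius norm, $\mathbf{1}_m\in\mathbb{R}^m$ is the vector of ones, and $R^+$ is the Moore–Penrose pseudoinverse of $R$. Minimizing $L$ determines the best quadratic model $\dot z=A(z\otimes z)+Bz+C$ for the given data and dictionary. *)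

theory Defs
  imports "HOL-Analysis.Analysis"
begin

section \<open>Matrices\<close>

text \<open>Vectors and matrices are the library's \<open>real ^ 'n\<close> and \<open>real ^ 'c ^ 'r\<close> (rows outside),
  with sizes given by index types. \<open>norm\<close> on \<open>real ^ 'n\<close> is the 2-norm.
  A Kronecker product is indexed by pairs and a stacked vector by a disjoint sum, so
  \<open>CARD(('N \<times> 'N) + 'N + 1) = N\<^sup>2 + N + 1\<close>.\<close>

definition kron :: "real ^ 'a::finite \<Rightarrow> real ^ 'b::finite \<Rightarrow> real ^ ('a \<times> 'b)"
  (infixl \<open>\<otimes>\<^sub>v\<close> 70) where
  "u \<otimes>\<^sub>v w = (\<chi> p. u $ fst p * w $ snd p)"

definition of_columns :: "('m \<Rightarrow> real ^ 'r) \<Rightarrow> real ^ 'm ^ 'r" where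
  "of_columns f = (\<chi> i k. f k $ i)"

definition ones :: "real ^ 'm" where
  "ones = (\<chi> k. 1)"

definition frobenius_norm :: "real ^ 'c ^ 'r \<Rightarrow> real" where
  "frobenius_norm M = sqrt (\<Sum>i\<in>UNIV. \<Sum>j\<in>UNIV. (M $ i $ j)\<^sup>2)"

text \<open>The four Penrose equations; over the reals they have exactly one solution \<open>X\<close>.\<close>

definition is_pseudoinverse :: "real ^ 'c ^ 'r \<Rightarrow> real ^ 'r ^ 'c \<Rightarrow> bool" where
  "is_pseudoinverse M X \<longleftrightarrow>
     M ** X ** M = M \<and> X ** M ** X = X \<and>
     transpose (M ** X) = M ** X \<and> transpose (X ** M) = X ** M"

definition pseudoinverse :: "real ^ 'c ^ 'r \<Rightarrow> real ^ 'r ^ 'c" where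
  "pseudoinverse M = (THE X. is_pseudoinverse M X)"

definition stack3 ::
  "real ^ 'a::finite \<Rightarrow> real ^ 'b::finite \<Rightarrow> real ^ 'c::finite \<Rightarrow> real ^ ('a + 'b + 'c)" where
  "stack3 u v w = (\<chi> p. case p of Inl i \<Rightarrow> u $ i | Inr (Inl i) \<Rightarrow> v $ i | Inr (Inr i) \<Rightarrow> w $ i)"

definition block3 ::
  "real ^ 'a::finite ^ 'a \<Rightarrow> real ^ 'b::finite ^ 'a \<Rightarrow> real ^ 'c::finite ^ 'a \<Rightarrow>
   real ^ 'a ^ 'b \<Rightarrow> real ^ 'b ^ 'b \<Rightarrow> real ^ 'c ^ 'b \<Rightarrow>
   real ^ 'a ^ 'c \<Rightarrow> real ^ 'b ^ 'c \<Rightarrow> real ^ 'c ^ 'c \<Rightarrow>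
   real ^ ('a + 'b + 'c) ^ ('a + 'b + 'c)" where
  "block3 M11 M12 M13 M21 M22 M23 M31 M32 M33 =
     (\<chi> p. case p of
         Inl i \<Rightarrow> stack3 (M11 $ i) (M12 $ i) (M13 $ i)
       | Inr (Inl i) \<Rightarrow> stack3 (M21 $ i) (M22 $ i) (M23 $ i)
       | Inr (Inr i) \<Rightarrow> stack3 (M31 $ i) (M32 $ i) (M33 $ i))"


section \<open>Data matrices\<close>

definition lifted_states :: "(real ^ 'n \<Rightarrow> real ^ 'N) \<Rightarrow> ('m \<Rightarrow> real ^ 'n) \<Rightarrow> real ^ 'm ^ 'N" where
  "lifted_states \<phi> x = of_columns (\<lambda>k. \<phi> (x k))"

definition lifted_squares ::
  "(real ^ 'n \<Rightarrow> real ^ 'N::finite) \<Rightarrow> ('m \<Rightarrow> real ^ 'n) \<Rightarrow> real ^ 'm ^ ('N \<times> 'N)" where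
  "lifted_squares \<phi> x = of_columns (\<lambda>k. \<phi> (x k) \<otimes>\<^sub>v \<phi> (x k))"

definition lifted_derivs ::
  "(real ^ 'n \<Rightarrow> real ^ 'N) \<Rightarrow> ('m \<Rightarrow> real ^ 'n) \<Rightarrow> ('m \<Rightarrow> real ^ 'n) \<Rightarrow> real ^ 'm ^ 'N" where
  "lifted_derivs \<phi> x xdot = of_columns (\<lambda>k. jacobian \<phi> (at (x k)) *v xdot k)"

lemma row_jacobian_is_gradient:
  fixes \<phi> :: "real ^ 'n \<Rightarrow> real ^ 'N"
  assumes "\<And>j. (\<lambda>y. \<phi> y $ j) differentiable (at x)"
  shows "GDERIV (\<lambda>y. \<phi> y $ i) x :> row i (jacobian \<phi> (at x))"
proof -
  have "\<phi> differentiable (at x)"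
  proof (subst differentiable_componentwise_within, intro ballI)
    fix b :: "real ^ 'N"
    assume "b \<in> Basis"
    then obtain j where b: "b = axis j 1"
      by (auto simp: Basis_vec_def)
    show "(\<lambda>y. \<phi> y \<bullet> b) differentiable (at x)"
      using assms[of j] by (simp add: b inner_axis)
  qed
  then have "(\<phi> has_derivative (\<lambda>h. jacobian \<phi> (at x) *v h)) (at x)"
    by (simp add: jacobian_works)
  then have "((\<lambda>y. \<phi> y $ i) has_derivative (\<lambda>h. (jacobian \<phi> (at x) *v h) $ i)) (at x)"
    by (rule bounded_linear.has_derivative[OF bounded_linear_vec_nth])
  then show ?thesis
    by (simp add: gderiv_def matrix_vector_mul_component row_def inner_commute)
qed


section \<open>The regression problem\<close>

definition loss ::
  "real ^ 'm ^ 'N::finite \<Rightarrow> real ^ 'm ^ ('N \<times> 'N) \<Rightarrow> real ^ 'm ^ 'N \<Rightarrow>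
   real ^ ('N \<times> 'N) ^ 'N \<Rightarrow> real ^ 'N ^ 'N \<Rightarrow> real ^ 'N \<Rightarrow> real" where
  "loss Z1 Z2 Zdot A B C =
     (frobenius_norm
        (Zdot - A ** Z2 - B ** Z1 - (columnvector C :: real ^ 1 ^ 'N) ** rowvector ones))\<^sup>2"

definition normal_matrix ::
  "real ^ 'm ^ 'N::finite \<Rightarrow> real ^ 'm ^ ('N \<times> 'N) \<Rightarrow>
   real ^ (('N \<times> 'N) + 'N + 1) ^ (('N \<times> 'N) + 'N + 1)" where
  "normal_matrix Z1 Z2 = block3
     (Z2 ** transpose Z2) (Z2 ** transpose Z1) (Z2 ** columnvector ones)
     (Z1 ** transpose Z2) (Z1 ** transpose Z1) (Z1 ** columnvector ones)
     (rowvector ones ** transpose Z2) (rowvector ones ** transpose Z1) (mat (real CARD('m)))"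

definition normal_rhs ::
  "real ^ 'm ^ 'N::finite \<Rightarrow> real ^ 'm ^ ('N \<times> 'N) \<Rightarrow> real ^ 'm ^ 'N \<Rightarrow> 'N \<Rightarrow>
   real ^ (('N \<times> 'N) + 'N + 1)" where
  "normal_rhs Z1 Z2 Zdot l =
     stack3 (Z2 *v row l Zdot) (Z1 *v row l Zdot) (rowvector ones *v row l Zdot)"

definition coeff_row ::
  "real ^ ('N \<times> 'N) ^ 'N::finite \<Rightarrow> real ^ 'N ^ 'N \<Rightarrow> real ^ 'N \<Rightarrow> 'N \<Rightarrow>
   real ^ (('N \<times> 'N) + 'N + 1)" where
  "coeff_row A B C l = stack3 (row l A) (row l B) (vec (C $ l))"

end

(* Stack the rows of Z2, Z1 and the all-ones row into one matrix D. Then R = D D^T, the vector s_l is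
   D applied to the l-th row of Zdot, and the loss is the sum over l of |Zdot_l^T - D^T v_l|^2. So
   R v_l = s_l is the normal equation of the l-th summand: it is always solvable, and by Pythagoras
   its solutions minimize. For R^+: the vector R^+ s_l is the image under the orthogonal projection
   R^+ R of every solution, hence the shortest one. *)
theory Submission
  imports Defs
begin

text \<open>As a simp rule it would turn \<open>transpose M *v w\<close> into \<open>w v* M\<close>;
  the arguments below keep \<open>*v\<close> throughout.\<close>

declare transpose_matrix_vector [simp del]

section \<open>The Moore--Penrose pseudoinverse\<close>

lemma inner_matrix_vector_mult:
  fixes M :: "real ^ 'c ^ 'r"
  shows "(M *v v) \<bullet> w = v \<bullet> (transpose M *v w)"
  by (metis dot_lmul_matrix inner_commute vector_transpose_matrix transpose_transpose)

text \<open>If M^T M w = 0, then |M w|^2 = w . M^T M w = 0, so M^T M has the same kernel as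
  M.\<close>

lemma transpose_mul_self_cancel_left:
  fixes M :: "real ^ 'c ^ 'r" and P Q :: "real ^ 'k ^ 'c"
  assumes "transpose M ** M ** P = transpose M ** M ** Q"
  shows "M ** P = M ** Q"
proof -
  have "(M ** P) *v v = (M ** Q) *v v" for v
  proof -
    define w where "w = P *v v - Q *v v"
    have "transpose M *v (M *v w) = 0"
      using assms by (simp add: w_def matrix_vector_mul_assoc matrix_mul_assoc
          matrix_vector_mult_diff_distrib)
    then have "(M *v w) \<bullet> (M *v w) = 0"
      by (simp add: inner_matrix_vector_mult)
    then have "M *v w = 0" by simp
    then show ?thesis
      by (simp add: w_def matrix_vector_mul_assoc matrix_vector_mult_diff_distrib)
  qed
  then show ?thesis by (simp add: matrix_eq)
qed

lemma mul_transpose_self_cancel_right: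
  fixes M :: "real ^ 'c ^ 'r" and P Q :: "real ^ 'r ^ 'k"
  assumes "P ** M ** transpose M = Q ** M ** transpose M"
  shows "P ** M = Q ** M"
proof -
  have "transpose (transpose M) ** transpose M ** transpose P
      = transpose (transpose M) ** transpose M ** transpose Q"
    using arg_cong[OF assms, of transpose]
    by (simp add: matrix_transpose_mul matrix_mul_assoc)
  then have "transpose M ** transpose P = transpose M ** transpose Q"
    by (rule transpose_mul_self_cancel_left)
  then show ?thesis
    by (metis matrix_transpose_mul transpose_transpose)
qed

text \<open>A linear right inverse of M on its range, written as a matrix, serves as G.\<close>

lemma generalized_inverse_exists:
  fixes M :: "real ^ 'c ^ 'r"
  shows "\<exists>G. M ** G ** M = M"
proof -
  obtain g where g: "linear g" "\<And>y. y \<in> range ((*v) M) \<Longrightarrow> M *v g y = y"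
    using linear_exists_right_inverse_on[OF matrix_vector_mul_linear[of M] subspace_UNIV]
    by blast
  have "M ** matrix g ** M = M"
    unfolding matrix_eq
    using g by (simp add: matrix_vector_mul_assoc[symmetric] matrix_works)
  then show ?thesis ..
qed

text \<open>The witness is \<open>X = M\<^sup>T G M\<^sup>T\<close> for a generalized inverse \<open>G\<close> of \<open>M\<^sup>T M M\<^sup>T\<close>;
  it satisfies \<open>M\<^sup>T M X = M\<^sup>T = X M M\<^sup>T\<close>, from which the Penrose equations follow.\<close>

lemma pseudoinverse_exists:
  fixes M :: "real ^ 'c ^ 'r"
  shows "\<exists>X. is_pseudoinverse M X"
proof -
  let ?T = "transpose M"
  obtain G where G: "(?T ** M ** ?T) ** G ** (?T ** M ** ?T) = ?T ** M ** ?T"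
    using generalized_inverse_exists by blast
  define X where "X = ?T ** G ** ?T"
  have "?T ** M ** ?T ** G ** ?T ** M = ?T ** M"
  proof (rule mul_transpose_self_cancel_right)
    show "?T ** M ** ?T ** G ** ?T ** M ** transpose M = ?T ** M ** transpose M"
      using G by (simp add: matrix_mul_assoc)
  qed
  \<comment> \<open>M is written as \<open>transpose ?T\<close> and a factor \<open>mat 1\<close> is
    inserted, so that right cancellation applies a second time, now with \<open>?T\<close> in the
    role of M.\<close>
  then have "(?T ** M ** ?T ** G) ** ?T ** transpose ?T = mat 1 ** ?T ** transpose ?T"
    by (simp add: matrix_mul_assoc)
  then have TMX: "?T ** M ** X = ?T"
    using mul_transpose_self_cancel_right[of "?T ** M ** ?T ** G" ?T "mat 1"]
    by (simp add: X_def matrix_mul_assoc)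
  have "M ** (?T ** G ** ?T ** M ** ?T) = M ** ?T"
  proof (rule transpose_mul_self_cancel_left)
    show "?T ** M ** (?T ** G ** ?T ** M ** ?T) = ?T ** M ** ?T"
      using G by (simp add: matrix_mul_assoc)
  qed
  then have "transpose ?T ** ?T ** (G ** ?T ** M ** ?T) = transpose ?T ** ?T ** mat 1"
    by (simp add: matrix_mul_assoc)
  then have XMT: "X ** M ** ?T = ?T"
    using transpose_mul_self_cancel_left[of ?T "G ** ?T ** M ** ?T" "mat 1"]
    by (simp add: X_def matrix_mul_assoc)
  have sym1: "transpose (M ** X) = M ** X"
  proof -
    \<comment> \<open>The right-hand side is Y^T Y for Y = M X, hence symmetric; \<open>sym2\<close>
      uses Y Y^T for Y = X M in the same way.\<close>
    have "transpose (M ** X) = transpose X ** (?T ** M ** X)"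
      by (simp add: TMX matrix_transpose_mul)
    then show ?thesis
      by (metis matrix_transpose_mul matrix_mul_assoc transpose_transpose)
  qed
  have sym2: "transpose (X ** M) = X ** M"
  proof -
    have "transpose (X ** M) = (X ** M ** ?T) ** transpose X"
      by (simp add: XMT matrix_transpose_mul)
    then show ?thesis
      by (metis matrix_transpose_mul matrix_mul_assoc transpose_transpose)
  qed
  have "M ** X ** M = M"
    using arg_cong[OF TMX, of transpose] sym1
    by (metis matrix_transpose_mul matrix_mul_assoc transpose_transpose)
  moreover have "X ** M ** X = X"
    using XMT by (simp add: X_def matrix_mul_assoc)
  ultimately show ?thesis
    using sym1 sym2 unfolding is_pseudoinverse_def by blast
qed

text \<open>M X and M Y are both the orthogonal projection onto the range of M, and X M and Y M
  agree likewise. Then X = X M X = Y M Y = Y.\<close>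

lemma pseudoinverse_unique:
  fixes M :: "real ^ 'c ^ 'r"
  assumes X: "is_pseudoinverse M X" and Y: "is_pseudoinverse M Y"
  shows "X = Y"
proof -
  note X' = X[unfolded is_pseudoinverse_def] and Y' = Y[unfolded is_pseudoinverse_def]
  have "M ** X = (M ** Y) ** (M ** X)"
    using Y' by (simp add: matrix_mul_assoc)
  also have "\<dots> = transpose ((M ** X) ** (M ** Y))"
    unfolding matrix_transpose_mul[of "M ** X" "M ** Y"] using X' Y' by simp
  also have "\<dots> = M ** Y"
    using X' Y' by (simp add: matrix_mul_assoc)
  finally have MX: "M ** X = M ** Y" .
  have "X ** M = X ** (M ** Y ** M)"
    using Y' by simp
  also have "\<dots> = (X ** M) ** (Y ** M)"
    by (simp add: matrix_mul_assoc)
  also have "\<dots> = transpose ((Y ** M) ** (X ** M))"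
    unfolding matrix_transpose_mul[of "Y ** M" "X ** M"] using X' Y' by simp
  also have "(Y ** M) ** (X ** M) = Y ** (M ** X ** M)"
    by (simp add: matrix_mul_assoc)
  also have "transpose \<dots> = Y ** M"
    using X' Y' by simp
  finally have XM: "X ** M = Y ** M" .
  have "X = X ** M ** X" using X by (simp add: is_pseudoinverse_def)
  also have "\<dots> = Y ** M ** Y" by (metis MX XM matrix_mul_assoc)
  also have "\<dots> = Y" using Y by (simp add: is_pseudoinverse_def)
  finally show ?thesis .
qed

lemma is_pseudoinverse_pseudoinverse: "is_pseudoinverse M (pseudoinverse M)"
  unfolding pseudoinverse_def
  by (rule theI') (metis pseudoinverse_exists pseudoinverse_unique)

lemma pseudoinverse_solves:
  assumes "M *v v = b"
  shows "M *v (pseudoinverse M *v b) = b"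
  using assms is_pseudoinverse_pseudoinverse[of M]
  by (auto simp: is_pseudoinverse_def matrix_vector_mul_assoc)

lemma pseudoinverse_least_norm:
  fixes M :: "real ^ 'c ^ 'r"
  assumes v: "M *v v = b" and ne: "v \<noteq> pseudoinverse M *v b"
  shows "norm (pseudoinverse M *v b) < norm v"
proof -
  define P where "P = pseudoinverse M ** M"
  define u where "u = pseudoinverse M *v b"
  have P: "transpose P = P" "P ** P = P"
    using is_pseudoinverse_pseudoinverse[of M]
    by (simp_all add: P_def is_pseudoinverse_def matrix_mul_assoc)
  have u: "u = P *v v"
    using v by (auto simp: u_def P_def matrix_vector_mul_assoc)
  \<comment> \<open>P is symmetric and idempotent, so P v . (v - P v) = v . (P v - P P v) =
    0.\<close>
  have "u \<bullet> (v - u) = 0"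
    unfolding u inner_matrix_vector_mult
    by (simp add: P matrix_vector_mul_assoc matrix_vector_mult_diff_distrib)
  then have "(norm v)\<^sup>2 = (norm u)\<^sup>2 + (norm (v - u))\<^sup>2"
    using norm_add_Pythagorean[of u "v - u"] by (simp add: orthogonal_def)
  moreover have "norm (v - u) > 0" using ne by (simp add: u_def)
  ultimately have "(norm u)\<^sup>2 < (norm v)\<^sup>2" by simp
  then show ?thesis unfolding u_def by (rule power2_less_imp_less) simp
qed

section \<open>Least squares\<close>

lemma normal_equation_solvable:
  fixes D :: "real ^ 'm ^ 'p"
  shows "\<exists>v. (D ** transpose D) *v v = D *v y"
proof -
  define X where "X = pseudoinverse (transpose D)"
  have X: "transpose D ** X ** transpose D = transpose D"
      "transpose (transpose D ** X) = transpose D ** X"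
    using is_pseudoinverse_pseudoinverse[of "transpose D"]
    by (simp_all add: X_def is_pseudoinverse_def)
  \<comment> \<open>D^T X is symmetric, so D (D^T X) = D X^T D, which is the transpose of D^T X D^T
    = D^T.\<close>
  have "D ** transpose D ** X = D"
    using X by (metis matrix_transpose_mul matrix_mul_assoc transpose_transpose)
  then have "(D ** transpose D) *v (X *v y) = D *v y"
    by (simp add: matrix_vector_mul_assoc)
  then show ?thesis ..
qed

text \<open>The normal equation says that D kills the residual y - D^T v, which is therefore
  orthogonal to the range of D^T; passing from v to w adds the vector e of that range.\<close>

lemma normal_equation_minimizes:
  fixes D :: "real ^ 'm ^ 'p"
  assumes "(D ** transpose D) *v v = D *v y"
  shows "(norm (y - transpose D *v v))\<^sup>2 \<le> (norm (y - transpose D *v w))\<^sup>2"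
proof -
  define e where "e = transpose D *v (v - w)"
  have "(y - transpose D *v v) \<bullet> e = (v - w) \<bullet> (D *v (y - transpose D *v v))"
    by (simp add: e_def inner_matrix_vector_mult inner_commute)
  also have "\<dots> = 0"
    using assms by (simp add: matrix_vector_mul_assoc matrix_vector_mult_diff_distrib)
  finally have "(norm (y - transpose D *v v + e))\<^sup>2
      = (norm (y - transpose D *v v))\<^sup>2 + (norm e)\<^sup>2"
    by (simp add: norm_add_Pythagorean orthogonal_def)
  moreover have "y - transpose D *v v + e = y - transpose D *v w"
    by (simp add: e_def matrix_vector_mult_diff_distrib)
  ultimately show ?thesis by simp
qed

section \<open>The stacked data matrix\<close>

text \<open>For the lifted data, column k is the full feature vector (z \<otimes> z, z, 1) of the
  k-th sample.\<close>

definition stacked_data ::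
  "real ^ 'm ^ 'N::finite \<Rightarrow> real ^ 'm ^ ('N \<times> 'N) \<Rightarrow> real ^ 'm ^ (('N \<times> 'N) + 'N + 1)" where
  "stacked_data Z1 Z2 =
     (\<chi> p. case p of Inl i \<Rightarrow> Z2 $ i | Inr (Inl i) \<Rightarrow> Z1 $ i | Inr (Inr i) \<Rightarrow> ones)"

text \<open>Applied twice, this splits a sum over the stacked index into its three blocks.\<close>

lemma sum_UNIV_Plus:
  fixes f :: "'a::finite + 'b::finite \<Rightarrow> 'c::comm_monoid_add"
  shows "(\<Sum>p\<in>UNIV. f p) = (\<Sum>i\<in>UNIV. f (Inl i)) + (\<Sum>i\<in>UNIV. f (Inr i))"
  by (simp add: UNIV_Plus_UNIV[symmetric] sum.Plus del: UNIV_Plus_UNIV)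

lemma normal_matrix_eq:
  "normal_matrix Z1 Z2 = stacked_data Z1 Z2 ** transpose (stacked_data Z1 Z2)"
proof -
  have "normal_matrix Z1 Z2 $ p $ q
      = (stacked_data Z1 Z2 ** transpose (stacked_data Z1 Z2)) $ p $ q" for p q
    by (auto simp: normal_matrix_def stacked_data_def block3_def stack3_def matrix_matrix_mult_def
        transpose_def columnvector_def rowvector_def ones_def mat_def split: sum.split)
  then show ?thesis by (simp add: vec_eq_iff)
qed

lemma normal_rhs_eq: "normal_rhs Z1 Z2 Zdot l = stacked_data Z1 Z2 *v row l Zdot"
proof -
  have "normal_rhs Z1 Z2 Zdot l $ p = (stacked_data Z1 Z2 *v row l Zdot) $ p" for p
    by (auto simp: normal_rhs_def stacked_data_def stack3_def matrix_vector_mult_def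
        rowvector_def ones_def split: sum.split)
  then show ?thesis by (simp add: vec_eq_iff)
qed

text \<open>This is the decoupling: the squared Frobenius norm is the sum of the squared row norms,
  and row l of the residual involves only the l-th rows of A, B and C.\<close>

lemma loss_eq:
  fixes C :: "real ^ 'N"
  shows
  "loss Z1 Z2 Zdot A B C =
     (\<Sum>l\<in>UNIV. (norm (row l Zdot - transpose (stacked_data Z1 Z2) *v coeff_row A B C l))\<^sup>2)"
proof -
  have "(Zdot - A ** Z2 - B ** Z1 - (columnvector C :: real ^ 1 ^ 'N) ** rowvector ones) $ l $ k
      = (row l Zdot - transpose (stacked_data Z1 Z2) *v coeff_row A B C l) $ k" for l k
    by (simp add: stacked_data_def coeff_row_def stack3_def matrix_matrix_mult_def
        matrix_vector_mult_def transpose_def columnvector_def rowvector_def ones_def row_def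
        sum_UNIV_Plus mult.commute)
  then show ?thesis
    by (simp add: loss_def frobenius_norm_def norm_vec_def L2_set_def sum_nonneg)
qed

text \<open>Solutions chosen separately for each l can thus be reassembled into one triple (A, B,
  C).\<close>

lemma coeff_row_surj: "\<exists>A B C. \<forall>l. coeff_row A B C l = v l"
proof (intro exI allI)
  fix l
  show "coeff_row (\<chi> l i. v l $ Inl i) (\<chi> l i. v l $ Inr (Inl i)) (\<chi> l. v l $ Inr (Inr 1)) l = v l"
    by (auto simp: coeff_row_def stack3_def row_def vec_eq_iff split: sum.split)
qed


theorem mainTheorem2:
  fixes \<phi> :: "real ^ 'n \<Rightarrow> real ^ 'N"
    and x xdot :: "'m::finite \<Rightarrow> real ^ 'n"
    and Z1 Zdot :: "real ^ 'm ^ 'N"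
    and Z2 :: "real ^ 'm ^ ('N \<times> 'N)"
    and R :: "real ^ (('N \<times> 'N) + 'N + 1) ^ (('N \<times> 'N) + 'N + 1)"
    and s :: "'N \<Rightarrow> real ^ (('N \<times> 'N) + 'N + 1)"
  assumes "\<And>i y. (\<lambda>u. \<phi> u $ i) differentiable (at y)"
    and "Z1 = lifted_states \<phi> x"
    and "Z2 = lifted_squares \<phi> x"
    and "Zdot = lifted_derivs \<phi> x xdot"
    and "R = normal_matrix Z1 Z2"
    and "s = normal_rhs Z1 Z2 Zdot"
  shows "(\<exists>A B C. \<forall>l. R *v coeff_row A B C l = s l) \<and>
         (\<forall>A B C. (\<forall>l. R *v coeff_row A B C l = s l) \<longrightarrow>
            is_arg_min (\<lambda>(A, B, C). loss Z1 Z2 Zdot A B C) (\<lambda>_. True) (A, B, C)) \<and>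
         (\<forall>l. R *v (pseudoinverse R *v s l) = s l \<and>
            (\<forall>v. R *v v = s l \<and> v \<noteq> pseudoinverse R *v s l \<longrightarrow>
               norm (pseudoinverse R *v s l) < norm v))"
proof -
  define D where "D = stacked_data Z1 Z2"
  have R: "R = D ** transpose D" and s: "\<And>l. s l = D *v row l Zdot"
    using assms(5,6) by (simp_all add: D_def normal_matrix_eq normal_rhs_eq)
  have "\<forall>l. \<exists>v. R *v v = s l"
    unfolding R s using normal_equation_solvable by blast
  then obtain v where v: "\<And>l. R *v v l = s l" by metis
  have "\<exists>A B C. \<forall>l. R *v coeff_row A B C l = s l"
    using coeff_row_surj[of v] v by metis
  moreover have "is_arg_min (\<lambda>(A, B, C). loss Z1 Z2 Zdot A B C) (\<lambda>_. True) (A, B, C)"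
    if "\<forall>l. R *v coeff_row A B C l = s l" for A B C
  proof -
    \<comment> \<open>Each summand of \<open>loss_eq\<close> is already minimal over all vectors, so
      the sums compare term by term.\<close>
    have "loss Z1 Z2 Zdot A B C \<le> loss Z1 Z2 Zdot A' B' C'" for A' B' C'
      unfolding loss_eq using that
      by (intro sum_mono normal_equation_minimizes) (simp add: R s flip: D_def)
    then show ?thesis by (auto simp: is_arg_min_linorder)
  qed
  moreover have "R *v (pseudoinverse R *v s l) = s l" for l
    using v by (rule pseudoinverse_solves)
  ultimately show ?thesis
    using pseudoinverse_least_norm by blast
qed

end
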